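(* Let $\Delta$ be a polygonal domain with a countable family of obstacles $\mathcal O=\{B_z: z\in\mathcal I\}$, let $\mathcal A$ be the set of admissible states of the brick-breaker, equipped with its Lebesgue measure $\lambda$, and let $\mathcal S\subset\mathcal A$ be the set of admissible states $(x,\eta,\theta)$ for which there exists $t>0$ such that the trajectory is defined on $[0,t)$ and at time $t$ its position reaches a point of $S^{\eta_{t-}}$, where $\eta_{t-}$ is the configuration just before time $t$. Then $\lambda(\mathcal S)=0$.
   Context: A domain is a polygonal subset of $\mathbb R^2$ with non-empty interior which is a finite intersection of half-planes (possibly unbounded, possibly all of $\mathbb R^2$); an obstacle is a compact domain. Given are a domain $\Delta$ and a family $\mathcal O=\{B_z:z\in\mathcal I\}$, $\mathcal I$ countable, of obstacles contained in $\Delta$ with pairwise disjoint interiors, such that every ball meets only finitely many obstacles; the angles and side lengths of the polygons are assumed uniformly bounded below. A configuration is $\eta\in\{0,1\}^{\mathcal I}$; $\mathcal O(\eta)=\{B_z:\eta(z)=1\}$ is the set of present obstacles; $\mathcal C$ is the (countable) set of well-filled configurations, i.e. those with $\eta(z)=0$ for only finitely many $z$. $\Delta^\eta$ is the closure of $\Delta\setminus\bigcup_{B\in\mathcal O(\eta)}B$. $S^\eta$ is the set of all vertices of $\Delta$ and of the polygons in $\mathcal O(\eta)$. With $v(\theta)=(\cos\theta,\sin\theta)$, a state $(x,\eta,\theta)$ with $\eta\in\mathcal C$, $x\in\Delta^\eta$, $\theta\in\mathbb R/2\pi\mathbb Z$ is admissible if $x+s\,v(\theta)\in\operatorname{int}(\Delta^\eta)$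 for all sufficiently small $s>0$; $\mathcal A$ is the set of admissible states. The measure $\lambda$ on $\mathcal A$ is the sum over $\eta\in\mathcal C$ of Lebesgue measure on $\Delta^\eta\times\mathbb S^1$ (restricted to the admissible states with configuration $\eta$). Brick-breaker semi-flow $\Phi_t$: the point moves in a straight line with unit velocity $v(\theta)$ in $\Delta^\eta$; when (at a positive time) it hits $\partial\Delta^\eta$ at a point not in $S^\eta$, its velocity is reflected specularly with respect to the boundary segment hit; if the point hit belongs to a present obstacle, this obstacle is moreover removed from the configuration at that instant; if it lies on $\partial\Delta$ the configuration is unchanged. The motion then continues in the new domain. The trajectory is not continued if it hits a point of $S^\eta$, $\eta$ being the current configuration. *)

theory Defs
  imports "HOL-Analysis.Analysis"
begin

definition polygonal_domain :: "(real^2) set \<Rightarrow> bool" where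
  "polygonal_domain P \<longleftrightarrow> polyhedron P \<and> interior P \<noteq> {}"

definition obstacle :: "(real^2) set \<Rightarrow> bool" where
  "obstacle P \<longleftrightarrow> polygonal_domain P \<and> compact P"

definition vertices :: "(real^2) set \<Rightarrow> (real^2) set" where
  "vertices P = {p. p extreme_point_of P}"

(* The angle at a vertex p is the angle between the two sides meeting at p, each side being
   represented by one of its points other than p; P is convex, so it lies strictly between
   0 and pi. *)
definition interior_angles :: "(real^2) set \<Rightarrow> real set" where
  "interior_angles P =
     {arccos (((a - p) \<bullet> (b - p)) / (norm (a - p) * norm (b - p))) | p a b e f.
        p \<in> vertices P \<and> e edge_of P \<and> f edge_of P \<and> e \<noteq> f \<and>
        p \<in> e \<and> p \<in> f \<and> a \<in> e - {p} \<and> b \<in> f - {p}}"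

(* Unbounded sides have infinite length and impose no condition. *)
definition side_lengths :: "(real^2) set \<Rightarrow> real set" where
  "side_lengths P = {diameter e | e. e edge_of P \<and> bounded e}"

definition uniformly_nondegenerate :: "(real^2) set set \<Rightarrow> bool" where
  "uniformly_nondegenerate \<P> \<longleftrightarrow>
     (\<exists>c>0. \<forall>P\<in>\<P>. (\<forall>\<alpha>\<in>interior_angles P. c \<le> \<alpha>) \<and> (\<forall>l\<in>side_lengths P. c \<le> l))"

definition well_filled :: "'i set \<Rightarrow> ('i \<Rightarrow> nat) set" where
  "well_filled I = {\<eta> \<in> I \<rightarrow>\<^sub>E {0, 1}. finite {z \<in> I. \<eta> z = 0}}"

definition table ::
    "(real^2) set \<Rightarrow> 'i set \<Rightarrow> ('i \<Rightarrow> (real^2) set) \<Rightarrow> ('i \<Rightarrow> nat) \<Rightarrow> (real^2) set" where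
  "table \<Delta> I B \<eta> = closure (\<Delta> - (\<Union>z\<in>{z \<in> I. \<eta> z = 1}. B z))"

definition corners ::
    "(real^2) set \<Rightarrow> 'i set \<Rightarrow> ('i \<Rightarrow> (real^2) set) \<Rightarrow> ('i \<Rightarrow> nat) \<Rightarrow> (real^2) set" where
  "corners \<Delta> I B \<eta> = vertices \<Delta> \<union> (\<Union>z\<in>{z \<in> I. \<eta> z = 1}. vertices (B z))"

definition dir :: "real \<Rightarrow> real^2" where
  "dir \<theta> = vector [cos \<theta>, sin \<theta>]"

(* A state is listed as (configuration, position, angle).  The circle of directions is
   represented by the angles in [0, 2*pi). *)
type_synonym 'i state = "('i \<Rightarrow> nat) \<times> (real^2) \<times> real"

definition admissible ::
    "(real^2) set \<Rightarrow> 'i set \<Rightarrow> ('i \<Rightarrow> (real^2) set) \<Rightarrow> 'i state set" where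
  "admissible \<Delta> I B =
     {(\<eta>, x, \<theta>). \<eta> \<in> well_filled I \<and> x \<in> table \<Delta> I B \<eta> \<and> \<theta> \<in> {0..<2*pi} \<and>
        (\<forall>\<^sub>F s in at_right 0. x + s *\<^sub>R dir \<theta> \<in> interior (table \<Delta> I B \<eta>))}"

(* For countable I the set of configurations is countable, so a set is measurable for this
   product iff all its slices at fixed configuration are Lebesgue measurable, and its measure
   is the sum over the configurations of the Lebesgue measures of the slices. *)
definition state_measure ::
    "(real^2) set \<Rightarrow> 'i set \<Rightarrow> ('i \<Rightarrow> (real^2) set) \<Rightarrow> 'i state measure" where
  "state_measure \<Delta> I B =
     restrict_space (count_space (well_filled I) \<Otimes>\<^sub>M (lebesgue :: ((real^2) \<times> real) measure))
       (admissible \<Delta> I B)"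

definition specular :: "(real^2) set \<Rightarrow> real^2 \<Rightarrow> real^2 \<Rightarrow> bool" where
  "specular F v w \<longleftrightarrow>
     (\<exists>n. norm n = 1 \<and> (\<forall>a\<in>F. \<forall>b\<in>F. n \<bullet> (a - b) = 0) \<and> w = v - (2 * (v \<bullet> n)) *\<^sub>R n)"

(* A boundary point of the table that is not a corner lies on exactly one side F among the
   sides of Delta and of the present obstacles, so exactly one rule applies. *)
inductive collision ::
    "(real^2) set \<Rightarrow> 'i set \<Rightarrow> ('i \<Rightarrow> (real^2) set) \<Rightarrow> 'i state \<Rightarrow> 'i state \<Rightarrow> bool"
  for \<Delta> I B where
  wall: "\<lbrakk>p \<in> frontier (table \<Delta> I B \<eta>); p \<notin> corners \<Delta> I B \<eta>;
          F edge_of \<Delta>; p \<in> F;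
          \<theta>' \<in> {0..<2*pi}; specular F (dir \<theta>) (dir \<theta>')\<rbrakk>
         \<Longrightarrow> collision \<Delta> I B (\<eta>, p, \<theta>) (\<eta>, p, \<theta>')"
| brick: "\<lbrakk>p \<in> frontier (table \<Delta> I B \<eta>); p \<notin> corners \<Delta> I B \<eta>;
          z \<in> I; \<eta> z = 1; F edge_of B z; p \<in> F;
          \<theta>' \<in> {0..<2*pi}; specular F (dir \<theta>) (dir \<theta>')\<rbrakk>
         \<Longrightarrow> collision \<Delta> I B (\<eta>, p, \<theta>) (\<eta>(z := 0), p, \<theta>')"

(* flow \<Delta> I B st s st' means that the semi-flow at time s is defined at st with value st'.
   It is right-continuous in time: at a collision time only the state after the collision is
   related. There is no state at a time when a corner is reached. *)
inductive flow ::
    "(real^2) set \<Rightarrow> 'i set \<Rightarrow> ('i \<Rightarrow> (real^2) set) \<Rightarrow> 'i state \<Rightarrow> real \<Rightarrow> 'i state \<Rightarrow> bool"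
  for \<Delta> I B where
  free: "\<lbrakk>0 \<le> s; \<forall>r\<in>{0<..s}. x + r *\<^sub>R dir \<theta> \<in> interior (table \<Delta> I B \<eta>)\<rbrakk>
         \<Longrightarrow> flow \<Delta> I B (\<eta>, x, \<theta>) s (\<eta>, x + s *\<^sub>R dir \<theta>, \<theta>)"
| hit: "\<lbrakk>0 < \<tau>; \<forall>r\<in>{0<..<\<tau>}. x + r *\<^sub>R dir \<theta> \<in> interior (table \<Delta> I B \<eta>);
         collision \<Delta> I B (\<eta>, x + \<tau> *\<^sub>R dir \<theta>, \<theta>) st; flow \<Delta> I B st s st'\<rbrakk>
         \<Longrightarrow> flow \<Delta> I B (\<eta>, x, \<theta>) (\<tau> + s) st'"

(* H, X and T are the configuration, position and angle along the trajectory; \<eta>' and p are the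
   left limits at t of H and X. The set of configurations is discrete, so the left limit of H
   is its eventual value. *)
definition singular_states ::
    "(real^2) set \<Rightarrow> 'i set \<Rightarrow> ('i \<Rightarrow> (real^2) set) \<Rightarrow> 'i state set" where
  "singular_states \<Delta> I B =
     {st \<in> admissible \<Delta> I B.
        \<exists>t>0. \<exists>H X T. (\<forall>s\<in>{0..<t}. flow \<Delta> I B st s (H s, X s, T s)) \<and>
          (\<exists>\<eta>' p. (\<forall>\<^sub>F s in at_left t. H s = \<eta>') \<and> (X \<longlongrightarrow> p) (at_left t) \<and>
             p \<in> corners \<Delta> I B \<eta>')}"

end

theory Submission
  imports Defs
begin

text \<open>
  The proof unfolds trajectories. Reflecting the table instead of the velocity turns the first
  \<open>n\<close> segments of a trajectory that starts at \<open>x\<close> with angle \<open>\<theta>\<close> into an initial piece of the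
  single ray \<open>x + s v(\<theta>)\<close>. A corner reached after finitely many collisions becomes, after
  unfolding, the image of that corner under a finite word of reflections in sides. Sides and
  corners are countable, and so are these images
  (\<open>countable_corner_images\<close>). The position of a singular state therefore lies on the line of
  direction \<open>v(\<theta>)\<close> through one of countably many points that do not depend on the state
  (\<open>flow_unfold\<close>, \<open>singular_state_aims_at_corner_image\<close>). For a fixed point and a fixed angle
  this is one line in the plane, so by Fubini the set of such \<open>(x, \<theta>)\<close> is null
  (\<open>null_sets_lines_through_point\<close>).

  A trajectory might have infinitely many collisions before the time \<open>t\<close> at which it
  reaches the corner \<open>p\<close>, and then there is no finite word. This is dealt with as follows
  (\<open>limit_point_on_ray\<close>). Only finitely many sides come near \<open>p\<close>, so all collisions close to
  \<open>p\<close> occur on sides that contain \<open>p\<close>. Reflections in these sides fix \<open>p\<close> and preserve the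
  distance to \<open>p\<close>. If \<open>s < t\<close> is close to \<open>t\<close>, the distance of the later trajectory to \<open>p\<close> is
  the same as for the straight ray issued at time \<open>s\<close>; since it tends to 0, this straight ray
  hits \<open>p\<close> at time \<open>t\<close>. The finitely many collisions up to time \<open>s\<close> are enough for the
  unfolding.

  That argument compares positions at different times on one trajectory, so it needs
  that the relation \<open>flow\<close> is functional (\<open>flow_deterministic\<close>). This holds because at a
  boundary point that is not a corner every polygon involved coincides locally with a half-plane
  (\<open>locally_halfplane_at_side\<close>). Two obstacles meeting along sides there, or an obstacle resting
  against the outer wall, leave no room for the table.
\<close>

section \<open>Directions and reflections in the plane\<close>

lemma norm_dir [simp]: "norm (dir \<theta>) = 1"
  by (simp add: norm_eq_sqrt_inner inner_vec_def sum_2 dir_def power2_eq_square [symmetric])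

lemma dir_inj_on: "inj_on dir {0..<2*pi}"
proof (rule inj_onI)
  fix a b assume ab: "a \<in> {0..<2*pi}" "b \<in> {0..<2*pi}" "dir a = dir b"
  have "cos a = cos b" "sin a = sin b"
    using ab(3) by (metis dir_def vector_2)+
  then obtain k :: int where "a = b + 2 * pi * k"
    using sin_cos_eq_iff by metis
  then have k: "a - b = 2 * pi * k" by simp
  have "\<bar>a - b\<bar> < 2 * pi" using ab by auto
  then have "2 * pi * \<bar>real_of_int k\<bar> < 2 * pi * 1" by (simp add: k abs_mult)
  then have "\<bar>real_of_int k\<bar> < 1" using pi_gt_zero by simp
  then have "k = 0" by linarith
  with k show "a = b" by simp
qed

lemma orthogonal_plane_collinear:
  fixes n e d :: "real^2"
  assumes "n \<noteq> 0" "e \<noteq> 0" "n \<bullet> e = 0" "n \<bullet> d = 0"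
  shows "d = ((d \<bullet> e) / (e \<bullet> e)) *\<^sub>R e"
proof -
  define D where "D = d$1 * e$2 - d$2 * e$1"
  have h: "n$1 * e$1 + n$2 * e$2 = 0" "n$1 * d$1 + n$2 * d$2 = 0"
    using assms(3,4) by (simp_all add: inner_vec_def sum_2)
  have "n$1 * D = 0" "n$2 * D = 0" unfolding D_def using h by algebra+
  moreover have "n$1 \<noteq> 0 \<or> n$2 \<noteq> 0" using assms(1) by (auto simp: vec_eq_iff forall_2)
  ultimately have D0: "D = 0" by auto
  have "(e \<bullet> e) *\<^sub>R d = (d \<bullet> e) *\<^sub>R e"
    using D0 by (simp add: vec_eq_iff forall_2 inner_vec_def sum_2 D_def) algebra
  then have "inverse (e \<bullet> e) *\<^sub>R ((e \<bullet> e) *\<^sub>R d) = inverse (e \<bullet> e) *\<^sub>R ((d \<bullet> e) *\<^sub>R e)" by simp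
  then show ?thesis using assms(2) by (simp add: divide_inverse mult.commute)
qed

lemma unit_normals_of_side:
  fixes n m e :: "real^2"
  assumes "norm n = 1" "norm m = 1" "e \<noteq> 0" "n \<bullet> e = 0" "m \<bullet> e = 0"
  shows "m = n \<or> m = - n"
proof -
  have n1: "n \<bullet> n = 1" "n \<noteq> 0" using assms(1) by (auto simp: norm_eq_1)
  have "m = (m \<bullet> n) *\<^sub>R n"
    using orthogonal_plane_collinear [of e n m] assms n1 by (simp add: inner_commute)
  moreover from this have "\<bar>m \<bullet> n\<bar> = 1" using assms(1,2) by (metis mult.right_neutral norm_scaleR)
  ultimately show ?thesis by (metis abs_eq_iff' abs_1 scaleR_one scaleR_minus_left)
qed

lemma edge_two_points:
  assumes "F edge_of P"
  obtains a b where "a \<in> F" "b \<in> F" "a \<noteq> b"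
proof -
  have d: "aff_dim F = 1" using assms by (simp add: edge_of_def)
  then have "F \<noteq> {}" by auto
  then obtain a where "a \<in> F" by auto
  moreover have "\<not> F \<subseteq> {a}"
    using d aff_dim_subset [of F "{a}"] by auto
  ultimately show ?thesis using that by blast
qed

text \<open>
  Reflection in the line spanned by a side. The unit normal is determined up to sign and
  the base point up to a translation along the side, so the result does not depend on the choices.
\<close>

definition mirror_image :: "(real^2) set \<Rightarrow> real^2 \<Rightarrow> real^2" where
  "mirror_image F q =
     (let n = (SOME n. norm n = 1 \<and> (\<forall>a\<in>F. \<forall>b\<in>F. n \<bullet> (a - b) = 0)); a = (SOME a. a \<in> F)
      in q - (2 * (n \<bullet> (q - a))) *\<^sub>R n)"

text \<open>
  The unfolding step: reflecting the outgoing ray in the side that was hit yields the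
  straight continuation of the incoming ray.
\<close>

lemma mirror_image_reflected_ray:
  assumes F: "F edge_of P" and p: "p \<in> F" and sp: "specular F v w"
  shows "mirror_image F (p + s *\<^sub>R w) = p + s *\<^sub>R v"
proof -
  obtain n where n: "norm n = 1" "\<forall>a\<in>F. \<forall>b\<in>F. n \<bullet> (a - b) = 0" "w = v - (2 * (v \<bullet> n)) *\<^sub>R n"
    using sp unfolding specular_def by blast
  define m where "m = (SOME n. norm n = 1 \<and> (\<forall>a\<in>F. \<forall>b\<in>F. n \<bullet> (a - b) = 0))"
  have m: "norm m = 1" "\<forall>a\<in>F. \<forall>b\<in>F. m \<bullet> (a - b) = 0"
    using someI [of "\<lambda>n. norm n = 1 \<and> (\<forall>a\<in>F. \<forall>b\<in>F. n \<bullet> (a - b) = 0)" n] n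
    unfolding m_def by auto
  define c where "c = (SOME a. a \<in> F)"
  have c: "c \<in> F" unfolding c_def by (rule someI [of _ p]) (rule p)
  obtain a b where ab: "a \<in> F" "b \<in> F" "a \<noteq> b" using F by (rule edge_two_points)
  have "m = n \<or> m = - n"
    using unit_normals_of_side [of n m "a - b"] n m ab by auto
  moreover have "n \<bullet> (p - c) = 0" using n p c by auto
  moreover have "n \<bullet> w = - (v \<bullet> n)"
    using n(1,3) by (simp add: inner_diff_right norm_eq_1 inner_commute)
  ultimately have "(2 * (m \<bullet> (p + s *\<^sub>R w - c))) *\<^sub>R m = - (2 * s * (v \<bullet> n)) *\<^sub>R n"
    by (auto simp: inner_add_right inner_diff_right algebra_simps)
  then have "mirror_image F (p + s *\<^sub>R w) = p + s *\<^sub>R w + (2 * s * (v \<bullet> n)) *\<^sub>R n"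
    by (simp add: mirror_image_def m_def [symmetric] c_def [symmetric] Let_def)
  then show ?thesis using n(3) by (simp add: scaleR_diff_right mult.assoc mult.left_commute)
qed

text \<open>
  A reflection in a line through \<open>p\<close> is an isometry fixing \<open>p\<close>. Hence, as far as the distance to
  \<open>p\<close> is concerned, a collision with a side containing \<open>p\<close> is invisible.
\<close>

lemma reflected_ray_dist_fixed_point:
  assumes p: "p \<in> F" "c \<in> F" and sp: "specular F v w"
  shows "norm (c + s *\<^sub>R w - p) = norm (c + s *\<^sub>R v - p)"
proof -
  obtain n where n: "norm n = 1" "\<forall>a\<in>F. \<forall>b\<in>F. n \<bullet> (a - b) = 0" "w = v - (2 * (v \<bullet> n)) *\<^sub>R n"
    using sp unfolding specular_def by blast
  have nc: "n \<bullet> (c - p) = 0" "n \<bullet> n = 1" using n p by (auto simp: norm_eq_1)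
  define d where "d = c - p"
  have "(d + s *\<^sub>R w) \<bullet> (d + s *\<^sub>R w) = (d + s *\<^sub>R v) \<bullet> (d + s *\<^sub>R v)"
    using nc unfolding n(3) d_def [symmetric]
    by (simp add: inner_add_left inner_add_right inner_diff_left inner_diff_right inner_commute
        algebra_simps)
  then show ?thesis unfolding d_def by (simp add: norm_eq_sqrt_inner algebra_simps)
qed

section \<open>The boundary of a polygon away from its vertices\<close>

text \<open>The vector \<open>n\<close> is the outward unit normal of \<open>P\<close> at \<open>q\<close>.\<close>

definition locally_halfplane :: "(real^2) set \<Rightarrow> real^2 \<Rightarrow> real^2 \<Rightarrow> bool" where
  "locally_halfplane P q n \<longleftrightarrow>
     norm n = 1 \<and> (\<forall>\<^sub>F y in nhds q. y \<in> P \<longleftrightarrow> n \<bullet> (y - q) \<le> 0)"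

text \<open>
  Near the point \<open>q\<close>, which is interior to the base \<open>ab\<close>, the triangle \<open>abc\<close> fills the whole
  half-plane on the side of \<open>c\<close>: the barycentric coordinates of \<open>y\<close> with respect to \<open>a\<close> and \<open>b\<close>
  stay positive by continuity, and the sign of the third one is the side of the base.
\<close>

lemma convex_contains_half_disc:
  fixes P :: "(real^2) set"
  assumes P: "convex P" and abc: "a \<in> P" "b \<in> P" "c \<in> P" and q: "q \<in> open_segment a b"
    and n: "n \<bullet> (a - b) = 0" "n \<bullet> (c - q) < 0"
  shows "\<forall>\<^sub>F y in nhds q. n \<bullet> (y - q) \<le> 0 \<longrightarrow> y \<in> P"
proof -
  obtain u where u: "0 < u" "u < 1" "q = (1 - u) *\<^sub>R a + u *\<^sub>R b"
    using q by (auto simp: in_segment)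
  have ab: "b - a \<noteq> 0" using q by (auto simp: open_segment_def)
  have n0: "n \<noteq> 0" using n by auto
  \<comment> \<open>\<open>\<alpha> y\<close>, \<open>1 - \<alpha> y - w y\<close> and \<open>w y\<close> are the barycentric coordinates of \<open>y\<close> with respect to
    \<open>c\<close>, \<open>a\<close>, \<open>b\<close>; \<open>\<beta>\<close> is the displacement along the base.\<close>
  define \<alpha> where "\<alpha> y = (n \<bullet> (y - q)) / (n \<bullet> (c - q))" for y
  define \<beta> where "\<beta> y = ((y - q - \<alpha> y *\<^sub>R (c - q)) \<bullet> (b - a)) / ((b - a) \<bullet> (b - a))" for y
  define w where "w y = (1 - \<alpha> y) * u + \<beta> y" for y
  have y_eq: "y = \<alpha> y *\<^sub>R c + ((1 - \<alpha> y - w y) *\<^sub>R a + w y *\<^sub>R b)" for y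
  proof -
    have "n \<bullet> (y - q - \<alpha> y *\<^sub>R (c - q)) = 0"
      using n(2) by (simp add: \<alpha>_def inner_diff_right [of n "y - q"])
    moreover have "n \<bullet> (b - a) = 0" using n(1) by (simp add: inner_diff_right)
    ultimately have "y - q - \<alpha> y *\<^sub>R (c - q) = \<beta> y *\<^sub>R (b - a)"
      unfolding \<beta>_def using orthogonal_plane_collinear n0 ab by blast
    then have "y = q + \<alpha> y *\<^sub>R (c - q) + \<beta> y *\<^sub>R (b - a)" by (simp add: algebra_simps)
    then show ?thesis unfolding w_def u(3) by (simp add: algebra_simps)
  qed
  have lim: "(\<alpha> \<longlongrightarrow> 0) (nhds q)" 
  proof -
    have "continuous_on UNIV \<alpha>" unfolding \<alpha>_def using n(2) by (intro continuous_intros) auto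
    then have "(\<alpha> \<longlongrightarrow> \<alpha> q) (nhds q)"
      by (simp add: continuous_on_eq_continuous_at continuous_at tendsto_at_iff_tendsto_nhds)
    then show ?thesis by (simp add: \<alpha>_def)
  qed
  have limb: "(\<beta> \<longlongrightarrow> 0) (nhds q)"
  proof -
    have "(\<beta> \<longlongrightarrow> ((q - q - 0 *\<^sub>R (c - q)) \<bullet> (b - a)) / ((b - a) \<bullet> (b - a))) (nhds q)"
      unfolding \<beta>_def by (intro tendsto_intros lim filterlim_ident) (use ab in auto)
    then show ?thesis by simp
  qed
  have limw: "(w \<longlongrightarrow> u) (nhds q)"
    unfolding w_def by (rule tendsto_eq_intros lim limb refl)+ simp
  have limr: "((\<lambda>y. 1 - \<alpha> y - w y) \<longlongrightarrow> 1 - u) (nhds q)"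
    by (rule tendsto_eq_intros lim limw refl)+ simp
  have "\<forall>\<^sub>F y in nhds q. 0 < w y" "\<forall>\<^sub>F y in nhds q. 0 < 1 - \<alpha> y - w y"
    using order_tendstoD(1) [OF limw, of 0] order_tendstoD(1) [OF limr, of 0] u by auto
  then show ?thesis
  proof eventually_elim
    case (elim y)
    show ?case
    proof
      assume "n \<bullet> (y - q) \<le> 0"
      then have "0 \<le> \<alpha> y" using n(2) by (simp add: \<alpha>_def divide_nonpos_neg)
      moreover have "{c, a, b} \<subseteq> P" using abc by auto
      ultimately have "\<alpha> y *\<^sub>R c + (1 - \<alpha> y - w y) *\<^sub>R a + w y *\<^sub>R b \<in> convex hull {c, a, b}"
        unfolding convex_hull_3 using elim
        by (intro CollectI exI [of _ "\<alpha> y"] exI [of _ "1 - \<alpha> y - w y"] exI [of _ "w y"]) auto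
      moreover have "convex hull {c, a, b} \<subseteq> P" using abc P by (intro hull_minimal) auto
      ultimately show "y \<in> P" using y_eq [of y, symmetric] by (auto simp: add.assoc)
    qed
  qed
qed

text \<open>
  A non-extreme point \<open>q\<close> of a side lies strictly inside that side, so the triangle spanned by
  the side and a point of \<open>P\<close> off its line contains a half-disc at \<open>q\<close>. Points of \<open>P\<close> on both
  sides of the line would give two half-discs and make \<open>q\<close> an interior point, whereas a proper
  face avoids the interior.
\<close>

lemma locally_halfplane_at_side:
  assumes P: "polygonal_domain P" and F: "F edge_of P" and q: "q \<in> F" "q \<notin> vertices P"
    and n: "norm n = 1" "\<forall>a\<in>F. \<forall>b\<in>F. n \<bullet> (a - b) = 0"
  obtains k where "k = n \<or> k = - n" "locally_halfplane P q k"
proof -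
  have cP: "convex P" using P by (simp add: polygonal_domain_def polyhedron_imp_convex)
  have FP: "F face_of P" "F \<subseteq> P" using F by (auto simp: edge_of_def face_of_imp_subset)
  have "\<not> q extreme_point_of F"
    using q FP by (simp add: vertices_def extreme_point_of_face)
  then obtain a b where ab: "a \<in> F" "b \<in> F" "q \<in> open_segment a b"
    using q by (auto simp: extreme_point_of_def)
  have nab: "n \<bullet> (a - b) = 0" using n ab by auto
  have "\<exists>c\<in>P. n \<bullet> (c - q) \<noteq> 0"
  proof (rule ccontr)
    assume "\<not> ?thesis"
    then have "P \<subseteq> {y. n \<bullet> y = n \<bullet> q}" by (auto simp: inner_diff_right)
    then have "interior P \<subseteq> {}" using n interior_mono interior_hyperplane
      by (metis norm_zero zero_neq_one)
    then show False using P by (simp add: polygonal_domain_def)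
  qed
  then obtain c where c: "c \<in> P" "n \<bullet> (c - q) \<noteq> 0" by blast
  define k where "k = (if n \<bullet> (c - q) < 0 then n else - n)"
  have k: "k = n \<or> k = - n" "k \<bullet> (a - b) = 0" "k \<bullet> (c - q) < 0" "norm k = 1"
    using c nab n by (auto simp: k_def)
  have half: "\<forall>\<^sub>F y in nhds q. k \<bullet> (y - q) \<le> 0 \<longrightarrow> y \<in> P"
    using convex_contains_half_disc [OF cP _ _ c(1) ab(3) k(2,3)] ab FP by blast
  have other: "k \<bullet> (d - q) \<le> 0" if "d \<in> P" for d
  proof (rule ccontr)
    assume "\<not> ?thesis"
    then have "(- k) \<bullet> (d - q) < 0" "(- k) \<bullet> (a - b) = 0" using k by auto
    then have "\<forall>\<^sub>F y in nhds q. (- k) \<bullet> (y - q) \<le> 0 \<longrightarrow> y \<in> P"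
      using convex_contains_half_disc [OF cP _ _ that ab(3)] ab FP by blast
    with half have "\<forall>\<^sub>F y in nhds q. y \<in> P"
      by eventually_elim (use linear in force)
    then have "q \<in> interior P" by (metis eventually_nhds interiorI subsetI)
    moreover have "F \<noteq> P"
    proof
      assume "F = P"
      then have "aff_dim P = 1" using F by (simp add: edge_of_def)
      moreover have "aff_dim P = int (DIM(real^2))"
        using P by (metis aff_dim_nonempty_interior polygonal_domain_def)
      ultimately show False by simp
    qed
    ultimately show False using face_of_disjoint_interior FP q by blast
  qed
  have "locally_halfplane P q k"
    unfolding locally_halfplane_def using half other k(4) by (auto elim: eventually_mono)
  then show ?thesis using that k by blast
qed

text \<open>
  The reflection formula is even in the normal, so the normal in \<^const>\<open>specular\<close> may be taken to be
  the outward one, which depends on the polygon but not on the side.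
\<close>

lemma specular_at_side:
  assumes "polygonal_domain P" "F edge_of P" "q \<in> F" "q \<notin> vertices P" "specular F v w"
  obtains k where "locally_halfplane P q k" "w = v - (2 * (v \<bullet> k)) *\<^sub>R k"
proof -
  obtain n where n: "norm n = 1" "\<forall>a\<in>F. \<forall>b\<in>F. n \<bullet> (a - b) = 0" "w = v - (2 * (v \<bullet> n)) *\<^sub>R n"
    using assms(5) unfolding specular_def by blast
  obtain k where k: "k = n \<or> k = - n" "locally_halfplane P q k"
    by (rule locally_halfplane_at_side [OF assms(1-4) n(1,2)])
  show ?thesis by (rule that [OF k(2)]) (use k(1) n(3) in auto)
qed

lemma eventually_nhds_on_ray:
  fixes q u :: "real^2"
  assumes "\<forall>\<^sub>F y in nhds q. Q y"
  shows "\<forall>\<^sub>F s in at_right (0::real). Q (q + s *\<^sub>R u)"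
proof -
  have "((\<lambda>s. q + s *\<^sub>R u) \<longlongrightarrow> q + 0 *\<^sub>R u) (at_right 0)"
    by (intro tendsto_intros)
  then have "filterlim (\<lambda>s. q + s *\<^sub>R u) (nhds q) (at_right 0)" by simp
  then show ?thesis using assms by (rule eventually_compose_filterlim [rotated])
qed

lemma locally_halfplane_mono:
  assumes n: "locally_halfplane P q n" and m: "locally_halfplane Q q m" and "P \<subseteq> Q"
  shows "n = m"
proof (rule ccontr)
  assume ne: "n \<noteq> m"
  have u: "n \<bullet> n = 1" "m \<bullet> m = 1" using n m by (auto simp: locally_halfplane_def norm_eq_1)
  have "0 < (n - m) \<bullet> (n - m)" using ne by simp
  then have nm: "n \<bullet> m < 1" using u by (simp add: inner_diff_left inner_diff_right inner_commute)
  have "\<forall>\<^sub>F y in nhds q. n \<bullet> (y - q) \<le> 0 \<longrightarrow> m \<bullet> (y - q) \<le> 0"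
    using n m \<open>P \<subseteq> Q\<close> unfolding locally_halfplane_def
    by (auto elim: eventually_elim2)
  \<comment> \<open>Moving in the direction \<open>m - n\<close> leaves the half-plane of \<open>m\<close> but enters that of \<open>n\<close>.\<close>
  from eventually_nhds_on_ray [OF this, of "m - n"]
  have "\<forall>\<^sub>F s in at_right (0::real). s * (n \<bullet> m - 1) \<le> 0 \<longrightarrow> s * (1 - n \<bullet> m) \<le> 0"
    by (simp add: u inner_diff_right inner_commute)
  then have "\<forall>\<^sub>F s in at_right (0::real). False"
    using eventually_at_right_less [of "0::real"]
    by eventually_elim (use nm in \<open>auto simp: mult_le_0_iff\<close>)
  then show False by simp
qed

lemma locally_halfplane_disjoint_interiors:
  assumes n: "locally_halfplane P q n" and m: "locally_halfplane Q q m"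
    and disj: "interior P \<inter> interior Q = {}"
  shows "m = - n"
proof (rule ccontr)
  assume ne: "m \<noteq> - n"
  have u: "n \<bullet> n = 1" "m \<bullet> m = 1" using n m by (auto simp: locally_halfplane_def norm_eq_1)
  have "n + m \<noteq> 0" using ne by (metis add_eq_0_iff)
  then have "0 < (n + m) \<bullet> (n + m)" by simp
  then have nm: "- 1 < n \<bullet> m" using u by (simp add: inner_add_left inner_add_right inner_commute)
  have int: "\<forall>\<^sub>F y in nhds q. k \<bullet> (y - q) < 0 \<longrightarrow> y \<in> interior R"
    if R: "locally_halfplane R q k" for R k
  proof -
    obtain U where U: "open U" "q \<in> U" "\<forall>y\<in>U. y \<in> R \<longleftrightarrow> k \<bullet> (y - q) \<le> 0"
      using R unfolding locally_halfplane_def eventually_nhds by blast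
    have "open (U \<inter> {y. k \<bullet> (y - q) < 0})"
      by (intro open_Int U open_Collect_less continuous_intros)
    moreover have "U \<inter> {y. k \<bullet> (y - q) < 0} \<subseteq> R" using U(3) less_imp_le by fastforce
    ultimately have "U \<inter> {y. k \<bullet> (y - q) < 0} \<subseteq> interior R" by (simp add: interior_maximal)
    then show ?thesis unfolding eventually_nhds using U by (intro exI [of _ U]) auto
  qed
  have "\<forall>\<^sub>F y in nhds q. \<not> (n \<bullet> (y - q) < 0 \<and> m \<bullet> (y - q) < 0)"
    using int [OF n] int [OF m] by eventually_elim (use disj in blast)
  \<comment> \<open>The direction \<open>- (n + m)\<close> points into both open half-planes.\<close>
  from eventually_nhds_on_ray [OF this, of "- (n + m)"]
  have ray: "\<forall>\<^sub>F s in at_right (0::real).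
      \<not> (n \<bullet> (q + s *\<^sub>R - (n + m) - q) < 0 \<and> m \<bullet> (q + s *\<^sub>R - (n + m) - q) < 0)" .
  have "n \<bullet> (q + s *\<^sub>R - (n + m) - q) = - (s * (1 + n \<bullet> m))"
    and "m \<bullet> (q + s *\<^sub>R - (n + m) - q) = - (s * (1 + n \<bullet> m))" for s
    using u by (simp_all add: inner_commute [of m n] inner_diff_right distrib_left algebra_simps)
  then have neg: "n \<bullet> (q + s *\<^sub>R - (n + m) - q) < 0" "m \<bullet> (q + s *\<^sub>R - (n + m) - q) < 0"
    if "0 < s" for s
    using that nm by simp_all
  have "\<forall>\<^sub>F s in at_right (0::real). False"
    using ray eventually_at_right_less [of "0::real"] by eventually_elim (use neg in blast)
  then show False by simp
qed

lemma finite_edges: "polygonal_domain P \<Longrightarrow> finite {F. F edge_of P}"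
  by (rule finite_subset [OF _ finite_polyhedron_faces [of P]])
    (auto simp: polygonal_domain_def edge_of_def)

lemma finite_vertices: "polygonal_domain P \<Longrightarrow> finite (vertices P)"
  by (simp add: vertices_def polygonal_domain_def finite_polyhedron_extreme_points)

section \<open>The brick-breaker semi-flow is deterministic\<close>

locale brick_breaker =
  fixes \<Delta> :: "(real^2) set" and I :: "'i set" and B :: "'i \<Rightarrow> (real^2) set"
  assumes domain: "polygonal_domain \<Delta>"
    and countable_index: "countable I"
    and obstacles: "z \<in> I \<Longrightarrow> obstacle (B z)"
    and obstacles_subset: "z \<in> I \<Longrightarrow> B z \<subseteq> \<Delta>"
    and disjoint_interiors: "disjoint_family_on (\<lambda>z. interior (B z)) I"
    and locally_finite: "finite {z \<in> I. B z \<inter> ball x r \<noteq> {}}"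
begin

lemma obstacle_polygonal: "z \<in> I \<Longrightarrow> polygonal_domain (B z)"
  using obstacles by (simp add: obstacle_def)

lemma not_in_table_if_covered:
  assumes "\<forall>\<^sub>F y in nhds q. y \<in> \<Delta> \<longrightarrow> (\<exists>z\<in>I. \<eta> z = 1 \<and> y \<in> B z)"
  shows "q \<notin> table \<Delta> I B \<eta>"
proof -
  obtain U where U: "open U" "q \<in> U" "\<forall>y\<in>U. y \<in> \<Delta> \<longrightarrow> (\<exists>z\<in>I. \<eta> z = 1 \<and> y \<in> B z)"
    using assms unfolding eventually_nhds by blast
  then have "U \<inter> (\<Delta> - (\<Union>z\<in>{z \<in> I. \<eta> z = 1}. B z)) = {}" by blast
  then have "U \<inter> closure (\<Delta> - (\<Union>z\<in>{z \<in> I. \<eta> z = 1}. B z)) = {}"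
    using U(1) open_Int_closure_eq_empty by blast
  then show ?thesis unfolding table_def using U by blast
qed

lemma frontier_table_subset: "frontier (table \<Delta> I B \<eta>) \<subseteq> table \<Delta> I B \<eta>"
  unfolding table_def by (simp add: frontier_subset_closed)

text \<open>
  An obstacle inside the domain that shares a boundary point with it, both being half-planes
  there, fills the domain near that point.
\<close>

lemma wall_and_brick_exclusive:
  assumes q: "q \<in> frontier (table \<Delta> I B \<eta>)" and z: "z \<in> I" "\<eta> z = 1"
    and n: "locally_halfplane \<Delta> q n" and m: "locally_halfplane (B z) q m"
  shows False
proof -
  have "m = n" using locally_halfplane_mono [OF m n] obstacles_subset z by auto
  with n m have "\<forall>\<^sub>F y in nhds q. y \<in> \<Delta> \<longrightarrow> (\<exists>z\<in>I. \<eta> z = 1 \<and> y \<in> B z)"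
    unfolding locally_halfplane_def using z by (auto elim: eventually_elim2)
  from not_in_table_if_covered [OF this] show False using q frontier_table_subset by blast
qed

text \<open>
  Two different obstacles that are half-planes at the same point have opposite normals, because
  their interiors are disjoint. They then cover a neighbourhood of the point.
\<close>

lemma brick_unique:
  assumes q: "q \<in> frontier (table \<Delta> I B \<eta>)" and z: "z \<in> I" "\<eta> z = 1" "z' \<in> I" "\<eta> z' = 1"
    and n: "locally_halfplane (B z) q n" and m: "locally_halfplane (B z') q m"
  shows "z = z'"
proof (rule ccontr)
  assume "z \<noteq> z'"
  then have "interior (B z) \<inter> interior (B z') = {}"
    using disjoint_interiors z by (auto simp: disjoint_family_on_def)
  then have "m = - n" using locally_halfplane_disjoint_interiors [OF n m] by blast
  have "\<forall>\<^sub>F y in nhds q. y \<in> B z \<longleftrightarrow> n \<bullet> (y - q) \<le> 0"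
    and "\<forall>\<^sub>F y in nhds q. y \<in> B z' \<longleftrightarrow> 0 \<le> n \<bullet> (y - q)"
    using n m by (auto simp: locally_halfplane_def \<open>m = - n\<close>)
  then have "\<forall>\<^sub>F y in nhds q. y \<in> B z \<or> y \<in> B z'"
    by eventually_elim auto
  then have "\<forall>\<^sub>F y in nhds q. y \<in> \<Delta> \<longrightarrow> (\<exists>z\<in>I. \<eta> z = 1 \<and> y \<in> B z)"
    by eventually_elim (use z in blast)
  from not_in_table_if_covered [OF this] show False using q frontier_table_subset by blast
qed

lemma collision_cases:
  assumes "collision \<Delta> I B (\<eta>, p, \<theta>) st"
  obtains (wall_hit) k \<theta>' where "p \<in> frontier (table \<Delta> I B \<eta>)" "locally_halfplane \<Delta> p k"
      "st = (\<eta>, p, \<theta>')" "\<theta>' \<in> {0..<2*pi}" "dir \<theta>' = dir \<theta> - (2 * (dir \<theta> \<bullet> k)) *\<^sub>R k"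
  | (brick_hit) z k \<theta>' where "p \<in> frontier (table \<Delta> I B \<eta>)" "z \<in> I" "\<eta> z = 1"
      "locally_halfplane (B z) p k" "st = (\<eta>(z := 0), p, \<theta>')" "\<theta>' \<in> {0..<2*pi}"
      "dir \<theta>' = dir \<theta> - (2 * (dir \<theta> \<bullet> k)) *\<^sub>R k"
  using assms
proof cases
  case (wall F \<theta>')
  then have "p \<notin> vertices \<Delta>" by (simp add: corners_def)
  then obtain k where "locally_halfplane \<Delta> p k" "dir \<theta>' = dir \<theta> - (2 * (dir \<theta> \<bullet> k)) *\<^sub>R k"
    using specular_at_side [OF domain] wall by metis
  then show thesis using wall_hit wall by blast
next
  case (brick z F \<theta>')
  then have "p \<notin> vertices (B z)" by (simp add: corners_def)
  then obtain k where "locally_halfplane (B z) p k" "dir \<theta>' = dir \<theta> - (2 * (dir \<theta> \<bullet> k)) *\<^sub>R k"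
    using specular_at_side [OF obstacle_polygonal] brick by metis
  then show thesis using brick_hit brick by blast
qed

lemma collision_deterministic:
  assumes "collision \<Delta> I B s st" "collision \<Delta> I B s st'"
  shows "st = st'"
proof -
  obtain \<eta> p \<theta> where s: "s = (\<eta>, p, \<theta>)" by (metis prod_cases3)
  have ang: "\<alpha> = \<beta>" if "\<alpha> \<in> {0..<2*pi}" "\<beta> \<in> {0..<2*pi}" "dir \<alpha> = dir \<beta>" for \<alpha> \<beta>
    using that dir_inj_on by (auto dest: inj_onD)
  from assms(1) [unfolded s] show ?thesis
  proof (cases rule: collision_cases)
    case c1: (wall_hit k \<theta>1)
    from assms(2) [unfolded s] show ?thesis
    proof (cases rule: collision_cases)
      case c2: (wall_hit m \<theta>2)
      have "k = m" using locally_halfplane_mono c1(2) c2(2) by blast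
      then show ?thesis using ang [of \<theta>1 \<theta>2] c1 c2 by simp
    next
      case c2: (brick_hit z m \<theta>2)
      then show ?thesis using wall_and_brick_exclusive c1 by blast
    qed
  next
    case c1: (brick_hit z k \<theta>1)
    from assms(2) [unfolded s] show ?thesis
    proof (cases rule: collision_cases)
      case c2: (wall_hit m \<theta>2)
      then show ?thesis using wall_and_brick_exclusive c1 by blast
    next
      case c2: (brick_hit z' m \<theta>2)
      have "z = z'" using brick_unique c1 c2 by blast
      moreover from this have "k = m" using locally_halfplane_mono c1(4) c2(4) by blast
      ultimately show ?thesis using ang [of \<theta>1 \<theta>2] c1 c2 by simp
    qed
  qed
qed

lemma collision_not_interior:
  assumes "collision \<Delta> I B (\<eta>, p, \<theta>) st"
  shows "p \<notin> interior (table \<Delta> I B \<eta>)"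
  using assms by (cases rule: collision_cases) (auto simp: frontier_def)

lemma flow_nonneg: "flow \<Delta> I B st s st' \<Longrightarrow> 0 \<le> s"
  by (induction rule: flow.induct) auto

text \<open>
  The time of the first collision is forced: before it the position is interior to the
  table, at it the position is on the frontier.
\<close>

lemma flow_deterministic:
  assumes "flow \<Delta> I B st s st1" "flow \<Delta> I B st s st2"
  shows "st1 = st2"
  using assms
proof (induction arbitrary: st2 rule: flow.induct)
  case (free s x \<theta> \<eta>)
  from free.prems show ?case
  proof cases
    case free
    then show ?thesis by simp
  next
    case (hit \<tau> st' s')
    then have "x + \<tau> *\<^sub>R dir \<theta> \<in> interior (table \<Delta> I B \<eta>)"
      using free.hyps(2) flow_nonneg [OF hit(5)] by auto
    then show ?thesis using collision_not_interior hit by blast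
  qed
next
  case (hit \<tau> x \<theta> \<eta> st s st1)
  note hit1 = hit
  have out: "x + \<tau> *\<^sub>R dir \<theta> \<notin> interior (table \<Delta> I B \<eta>)"
    using collision_not_interior hit.hyps by blast
  from hit.prems show ?case
  proof cases
    case free
    then show ?thesis using out hit1(1) flow_nonneg [OF hit1(4)] by auto
  next
    case (hit \<tau>' st' s')
    have out': "x + \<tau>' *\<^sub>R dir \<theta> \<notin> interior (table \<Delta> I B \<eta>)"
      using collision_not_interior hit by blast
    have "\<tau> = \<tau>'"
      using out out' hit1(1,2) hit(2,3) by (metis greaterThanLessThan_iff linorder_neqE_linordered_idom)
    moreover from this have "st = st'" using collision_deterministic hit1(3) hit(4) by blast
    ultimately show ?thesis using hit1(5) hit by auto
  qed
qed

lemma flow_split: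
  assumes "flow \<Delta> I B st s' st'" "0 \<le> s" "s \<le> s'"
  obtains st'' where "flow \<Delta> I B st s st''" "flow \<Delta> I B st'' (s' - s) st'"
proof -
  have "\<exists>st''. flow \<Delta> I B st s st'' \<and> flow \<Delta> I B st'' (s' - s) st'"
    using assms
  proof (induction arbitrary: s rule: flow.induct)
    case (free s' x \<theta> \<eta>)
    have shift: "x + s *\<^sub>R dir \<theta> + r *\<^sub>R dir \<theta> = x + (s + r) *\<^sub>R dir \<theta>" for r
      by (simp add: algebra_simps)
    have "flow \<Delta> I B (\<eta>, x, \<theta>) s (\<eta>, x + s *\<^sub>R dir \<theta>, \<theta>)"
      using free by (intro flow.free) auto
    moreover have "flow \<Delta> I B (\<eta>, x + s *\<^sub>R dir \<theta>, \<theta>) (s' - s)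
        (\<eta>, x + s *\<^sub>R dir \<theta> + (s' - s) *\<^sub>R dir \<theta>, \<theta>)"
      using free by (intro flow.free) (auto simp: shift)
    ultimately show ?case by (auto simp: shift)
  next
    case (hit \<tau> x \<theta> \<eta> st u st')
    show ?case
    proof (cases "s < \<tau>")
      case True
      have shift: "x + s *\<^sub>R dir \<theta> + r *\<^sub>R dir \<theta> = x + (s + r) *\<^sub>R dir \<theta>" for r
        by (simp add: algebra_simps)
      have "flow \<Delta> I B (\<eta>, x, \<theta>) s (\<eta>, x + s *\<^sub>R dir \<theta>, \<theta>)"
        using hit True by (intro flow.free) auto
      moreover have "flow \<Delta> I B (\<eta>, x + s *\<^sub>R dir \<theta>, \<theta>) (\<tau> - s + u) st'"
        using hit True by (intro flow.hit) (auto simp: shift)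
      moreover have "\<tau> - s + u = \<tau> + u - s" by simp
      ultimately show ?thesis by metis
    next
      case False
      then obtain st'' where st'': "flow \<Delta> I B st (s - \<tau>) st''" "flow \<Delta> I B st'' (u - (s - \<tau>)) st'"
        using hit.IH [of "s - \<tau>"] hit.prems by auto
      have "flow \<Delta> I B (\<eta>, x, \<theta>) (\<tau> + (s - \<tau>)) st''"
        using hit st'' by (intro flow.hit) auto
      moreover have "\<tau> + (s - \<tau>) = s" "u - (s - \<tau>) = \<tau> + u - s" by simp_all
      ultimately show ?thesis using st''(2) by metis
    qed
  qed
  then show ?thesis using that by blast
qed

section \<open>Unfolding trajectories\<close>

definition sides :: "(real^2) set set" where
  "sides = {F. F edge_of \<Delta> \<or> (\<exists>z\<in>I. F edge_of B z)}"

lemma collision_side: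
  assumes "collision \<Delta> I B (\<eta>, p, \<theta>) st"
  obtains F \<eta>' \<theta>' where "F \<in> sides" "p \<in> F" "specular F (dir \<theta>) (dir \<theta>')" "st = (\<eta>', p, \<theta>')"
  using assms by cases (auto simp: sides_def)

lemma side_is_edge: "F \<in> sides \<Longrightarrow> \<exists>P. F edge_of P"
  by (auto simp: sides_def)

lemma countable_sides: "countable sides"
proof -
  have "sides = {F. F edge_of \<Delta>} \<union> (\<Union>z\<in>I. {F. F edge_of B z})" by (auto simp: sides_def)
  moreover have "countable ({F. F edge_of \<Delta>} \<union> (\<Union>z\<in>I. {F. F edge_of B z}))"
    by (intro countable_Un countable_UN countable_index countable_finite finite_edges domain
        obstacle_polygonal)
  ultimately show ?thesis by simp
qed

text \<open>
  By local finiteness only finitely many sides come within distance 1 of \<open>p\<close>, and those that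
  miss \<open>p\<close>, being closed, keep a positive distance from it.
\<close>

lemma sides_near_point:
  obtains r where "r > 0" "\<And>F. F \<in> sides \<Longrightarrow> F \<inter> ball p r \<noteq> {} \<Longrightarrow> p \<in> F"
proof -
  define E where "E = {F. F edge_of \<Delta>} \<union> (\<Union>z\<in>{z \<in> I. B z \<inter> ball p 1 \<noteq> {}}. {F. F edge_of B z})"
  have "finite E"
    unfolding E_def using finite_edges domain obstacle_polygonal locally_finite by auto
  have "closed F" if F: "F \<in> E" for F
  proof -
    obtain P where "polygonal_domain P" "F edge_of P"
      using F domain obstacle_polygonal by (auto simp: E_def)
    then show ?thesis
      by (metis edge_of_def face_of_polyhedron_polyhedron polygonal_domain_def polyhedron_imp_closed)
  qed
  then have "open (- \<Union>{F \<in> E. p \<notin> F})" using \<open>finite E\<close>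
    by (intro open_Compl closed_Union) auto
  moreover have "p \<in> - \<Union>{F \<in> E. p \<notin> F}" by auto
  ultimately obtain e where e: "e > 0" "ball p e \<subseteq> - \<Union>{F \<in> E. p \<notin> F}"
    by (meson open_contains_ball)
  show ?thesis
  proof (rule that [of "min 1 e"])
    show "min 1 e > 0" using e by simp
    fix F assume F: "F \<in> sides" "F \<inter> ball p (min 1 e) \<noteq> {}"
    then obtain y where y: "y \<in> F" "y \<in> ball p 1" "y \<in> ball p e" by auto
    have "F \<in> E" using F(1) y edge_of_imp_subset by (fastforce simp: E_def sides_def)
    then show "p \<in> F" using e(2) y by blast
  qed
qed

text \<open>
  All points at which a corner can be seen after unfolding: the images of the corners of
  all polygons, whether present or not, under words of reflections in arbitrary sides.
\<close>

inductive_set corner_images :: "(real^2) set" where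
  corner: "p \<in> vertices \<Delta> \<union> (\<Union>z\<in>I. vertices (B z)) \<Longrightarrow> p \<in> corner_images"
| mirror: "q \<in> corner_images \<Longrightarrow> F \<in> sides \<Longrightarrow> mirror_image F q \<in> corner_images"

lemma countable_corner_images: "countable corner_images"
proof -
  define C where "C = vertices \<Delta> \<union> (\<Union>z\<in>I. vertices (B z))"
  have "countable C"
    unfolding C_def
    by (intro countable_Un countable_UN countable_index countable_finite finite_vertices domain
        obstacle_polygonal)
  then have "countable (lists sides \<times> C)" using countable_sides by auto
  moreover have "q \<in> (\<lambda>(Fs, p). foldr mirror_image Fs p) ` (lists sides \<times> C)"
    if "q \<in> corner_images" for q
    using that
  proof induction
    case (corner p)
    then show ?case by (intro image_eqI [of _ _ "([], p)"]) (auto simp: C_def)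
  next
    case (mirror q F)
    then obtain Fs p where "q = foldr mirror_image Fs p" "Fs \<in> lists sides" "p \<in> C" by auto
    with mirror show ?case by (intro image_eqI [of _ _ "(F # Fs, p)"]) auto
  qed
  ultimately show ?thesis by (meson countable_image countable_subset subsetI)
qed

text \<open>
  One reflection per collision transports the target of the final ray back to the initial ray,
  and the length \<open>u\<close> still to be travelled adds up with the time \<open>s\<close>.
\<close>

lemma flow_unfold:
  assumes "flow \<Delta> I B (\<eta>, x, \<theta>) s (\<eta>', x', \<theta>')" "x' + u *\<^sub>R dir \<theta>' \<in> corner_images"
  shows "x + (s + u) *\<^sub>R dir \<theta> \<in> corner_images"
  using assms
proof (induction "(\<eta>, x, \<theta>)" s "(\<eta>', x', \<theta>')" arbitrary: \<eta> x \<theta> rule: flow.induct)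
  case free
  then show ?case by (auto simp: algebra_simps)
next
  case (hit \<tau> x \<theta> \<eta> st s)
  obtain F \<eta>1 \<theta>1 where F: "F \<in> sides" "x + \<tau> *\<^sub>R dir \<theta> \<in> F" "specular F (dir \<theta>) (dir \<theta>1)"
    "st = (\<eta>1, x + \<tau> *\<^sub>R dir \<theta>, \<theta>1)"
    using hit(3) by (rule collision_side)
  obtain P where P: "F edge_of P" using F side_is_edge by blast
  have "x + \<tau> *\<^sub>R dir \<theta> + (s + u) *\<^sub>R dir \<theta>1 \<in> corner_images" using hit(5) F hit.prems by blast
  from corner_images.mirror [OF this F(1)]
  have "x + \<tau> *\<^sub>R dir \<theta> + (s + u) *\<^sub>R dir \<theta> \<in> corner_images"
    using mirror_image_reflected_ray [OF P F(2,3)] by metis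
  then show ?case by (simp add: algebra_simps)
qed

text \<open>
  A trajectory that stays within distance \<open>r\<close> of \<open>p\<close> collides only with sides through \<open>p\<close>, so
  its distance to \<open>p\<close> evolves as along a straight ray. The speed being 1, the assumption
  on \<open>dist x p + s\<close> keeps it within that distance.
\<close>

lemma flow_dist_near_point:
  assumes near: "\<And>F. F \<in> sides \<Longrightarrow> F \<inter> ball p r \<noteq> {} \<Longrightarrow> p \<in> F"
    and "flow \<Delta> I B (\<eta>, x, \<theta>) s (\<eta>', x', \<theta>')" "dist x p + s < r"
  shows "norm (x' - p) = norm (x + s *\<^sub>R dir \<theta> - p)"
  using assms(2,3)
proof (induction "(\<eta>, x, \<theta>)" s "(\<eta>', x', \<theta>')" arbitrary: \<eta> x \<theta> rule: flow.induct)
  case free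
  then show ?case by auto
next
  case (hit \<tau> x \<theta> \<eta> st s)
  let ?c = "x + \<tau> *\<^sub>R dir \<theta>"
  obtain F \<eta>1 \<theta>1 where F: "F \<in> sides" "?c \<in> F" "specular F (dir \<theta>) (dir \<theta>1)"
    "st = (\<eta>1, ?c, \<theta>1)"
    using hit(3) by (rule collision_side)
  have "dist ?c x = \<tau>" using hit(1) by (simp add: dist_norm)
  then have d: "dist ?c p \<le> dist x p + \<tau>" using dist_triangle [of ?c p x] by simp
  then have "?c \<in> ball p r" using hit.prems flow_nonneg [OF hit(4)] by (simp add: dist_commute)
  then have "p \<in> F" using near F by blast
  have "norm (x' - p) = norm (?c + s *\<^sub>R dir \<theta>1 - p)" using hit(5) F d hit.prems by auto
  also have "\<dots> = norm (?c + s *\<^sub>R dir \<theta> - p)"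
    using reflected_ray_dist_fixed_point [OF \<open>p \<in> F\<close> F(2,3)] .
  finally show ?case by (simp add: algebra_simps)
qed

text \<open>
  This replaces a possibly infinite sequence of collisions before time \<open>t\<close> by a single straight
  ray issued at an earlier time. The time \<open>s\<close> is chosen such that both the distance to \<open>p\<close> and
  the remaining time are less than half of the radius within which all sides pass through \<open>p\<close>.
\<close>

lemma limit_point_on_ray:
  assumes t: "t > 0" and fl: "\<forall>s\<in>{0..<t}. flow \<Delta> I B st s (H s, X s, T s)"
    and X: "(X \<longlongrightarrow> p) (at_left t)"
  obtains s where "0 \<le> s" "s < t" "X s + (t - s) *\<^sub>R dir (T s) = p"
proof -
  obtain r where r: "r > 0" "\<And>F. F \<in> sides \<Longrightarrow> F \<inter> ball p r \<noteq> {} \<Longrightarrow> p \<in> F"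
    using sides_near_point by metis
  have "\<forall>\<^sub>F s in at_left t. dist (X s) p < r / 2"
    using tendstoD [OF X, of "r / 2"] r by simp
  moreover have "\<forall>\<^sub>F s in at_left t. s \<in> {max 0 (t - r / 2)<..<t}"
    using t r by (intro eventually_at_leftI [of "max 0 (t - r / 2)"]) auto
  ultimately have "\<forall>\<^sub>F s in at_left t. dist (X s) p < r / 2 \<and> s \<in> {max 0 (t - r / 2)<..<t}"
    by (rule eventually_conj)
  then obtain s where s: "dist (X s) p < r / 2" "0 \<le> s" "t - r / 2 < s" "s < t"
    using eventually_happens'[OF trivial_limit_at_left_real] by fastforce
  have eq: "norm (X s' - p) = norm (X s + (s' - s) *\<^sub>R dir (T s) - p)"
    if s': "s \<le> s'" "s' < t" for s'
  proof -
    have "flow \<Delta> I B st s' (H s', X s', T s')" using fl s' s by auto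
    then obtain st'' where st'': "flow \<Delta> I B st s st''" "flow \<Delta> I B st'' (s' - s) (H s', X s', T s')"
      by (rule flow_split [OF _ s(2) s'(1)])
    have "st'' = (H s, X s, T s)" using fl s flow_deterministic [OF st''(1)] by auto
    then show ?thesis
      using flow_dist_near_point [of p r, OF r(2)] st''(2) s s' by auto
  qed
  have lim: "((\<lambda>s'. norm (X s' - p)) \<longlongrightarrow> norm (p - p)) (at_left t)"
    by (intro tendsto_intros X)
  have "((\<lambda>s'. norm (X s + (s' - s) *\<^sub>R dir (T s) - p)) \<longlongrightarrow>
      norm (X s + (t - s) *\<^sub>R dir (T s) - p)) (at_left t)"
    by (intro tendsto_intros)
  moreover have "\<forall>\<^sub>F s' in at_left t. norm (X s + (s' - s) *\<^sub>R dir (T s) - p) = norm (X s' - p)"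
    using s(4) eq by (intro eventually_at_leftI [of s]) auto
  ultimately have "((\<lambda>s'. norm (X s' - p)) \<longlongrightarrow> norm (X s + (t - s) *\<^sub>R dir (T s) - p)) (at_left t)"
    by (rule Lim_transform_eventually)
  from tendsto_unique [OF trivial_limit_at_left_real this lim]
  have "X s + (t - s) *\<^sub>R dir (T s) = p" by simp
  then show ?thesis using that s by auto
qed

lemma singular_state_aims_at_corner_image:
  assumes "(\<eta>, x, \<theta>) \<in> singular_states \<Delta> I B"
  obtains t where "x + t *\<^sub>R dir \<theta> \<in> corner_images"
proof -
  obtain t H X T \<eta>' p where t: "t > 0"
    and fl: "\<forall>s\<in>{0..<t}. flow \<Delta> I B (\<eta>, x, \<theta>) s (H s, X s, T s)"
    and X: "(X \<longlongrightarrow> p) (at_left t)" and p: "p \<in> corners \<Delta> I B \<eta>'"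
    using assms unfolding singular_states_def by blast
  obtain s where s: "0 \<le> s" "s < t" "X s + (t - s) *\<^sub>R dir (T s) = p"
    using limit_point_on_ray [OF t fl X] by blast
  have "p \<in> corner_images" using p by (auto simp: corners_def intro!: corner_images.corner)
  then have "x + (s + (t - s)) *\<^sub>R dir \<theta> \<in> corner_images"
    using fl s flow_unfold by fastforce
  then show ?thesis using that by blast
qed

end

section \<open>Null sets of states\<close>

lemma null_sets_lines_through_point:
  fixes q :: "real^2"
  shows "{(x, \<theta>). \<exists>t. x + t *\<^sub>R dir \<theta> = q} \<in> null_sets lebesgue"
proof -
  \<comment> \<open>The condition that \<open>q - x\<close> is parallel to \<open>v(\<theta>)\<close>, written as the vanishing of a
    determinant, so that the set is closed.\<close>
  define N where "N = {z :: (real^2) \<times> real. (q - fst z)$1 * sin (snd z) - (q - fst z)$2 * cos (snd z) = 0}"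
  have "closed N"
    unfolding N_def by (intro closed_Collect_eq continuous_intros)
  then have N: "N \<in> sets (lborel \<Otimes>\<^sub>M lborel)" unfolding lborel_prod by simp
  have "emeasure lborel ((\<lambda>x. (x, \<theta>)) -` N) = 0" for \<theta>
  proof -
    \<comment> \<open>\<open>a\<close> is orthogonal to \<open>v(\<theta>)\<close>.\<close>
    define a :: "real^2" where "a = vector [sin \<theta>, - cos \<theta>]"
    have "a \<noteq> 0" using sin_zero_abs_cos_one [of \<theta>] by (auto simp: a_def vec_eq_iff forall_2)
    have eq: "(\<lambda>x. (x, \<theta>)) -` N = {x. a \<bullet> x = a \<bullet> q}"
      by (auto simp: N_def a_def inner_vec_def sum_2 algebra_simps)
    have "{x. a \<bullet> x = a \<bullet> q} \<in> null_sets lebesgue"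
      using negligible_hyperplane [of a] \<open>a \<noteq> 0\<close> by (simp add: negligible_iff_null_sets)
    then have "emeasure lebesgue {x. a \<bullet> x = a \<bullet> q} = 0" by auto
    then show ?thesis unfolding eq
      by (simp add: borel_closed closed_hyperplane)
  qed
  then have "emeasure (lborel \<Otimes>\<^sub>M lborel) N = 0"
    by (simp add: lborel_pair.emeasure_pair_measure_alt2 [OF N])
  then have "N \<in> null_sets (lborel :: ((real^2) \<times> real) measure)"
    unfolding lborel_prod using borel_closed [OF \<open>closed N\<close>] by (simp add: null_sets_def)
  moreover have "{(x, \<theta>). \<exists>t. x + t *\<^sub>R dir \<theta> = q} \<subseteq> N"
    by (auto simp: N_def dir_def)
  ultimately show ?thesis using null_sets_completionI null_sets_completion_subset by blast
qed

text \<open>A well-filled configuration is determined by its finite set of absent obstacles.\<close>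

lemma countable_well_filled:
  assumes "countable I"
  shows "countable (well_filled I)"
proof -
  define emb where "emb Z = restrict (\<lambda>z. if z \<in> Z then 0 else 1 :: nat) I" for Z :: "'a set"
  have "well_filled I \<subseteq> emb ` {Z. finite Z \<and> Z \<subseteq> I}"
  proof
    fix \<eta> assume \<eta>: "\<eta> \<in> well_filled I"
    have "\<eta> = emb {z \<in> I. \<eta> z = 0}"
      using \<eta> by (auto simp: emb_def well_filled_def PiE_iff extensional_def fun_eq_iff)
    then show "\<eta> \<in> emb ` {Z. finite Z \<and> Z \<subseteq> I}"
      using \<eta> by (auto simp: well_filled_def)
  qed
  moreover have "countable {Z. finite Z \<and> Z \<subseteq> I}"
    using assms by (rule countable_Collect_finite_subset)
  ultimately show ?thesis by (meson countable_image countable_subset)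
qed

text \<open>
  The measure of \<open>S\<close> in the restricted space is either its measure in \<open>M\<close> or, when the
  restriction does not yield a measure space, the default value 0; both vanish.
\<close>

lemma null_sets_restrict_spaceI:
  assumes "S \<in> null_sets M" "S \<subseteq> A"
  shows "S \<in> null_sets (restrict_space M A)"
proof -
  have "S = A \<inter> S" using assms by blast
  then have "S \<in> sets (restrict_space M A)" using assms by (metis imageI null_setsD2 sets_restrict_space)
  moreover have "emeasure (restrict_space M A) S = 0"
    using assms(1) unfolding restrict_space_def emeasure_measure_of_conv by auto
  ultimately show ?thesis by blast
qed

lemma null_sets_state_measureI:
  assumes I: "countable I" and S: "S \<subseteq> admissible \<Delta> I B"
    and slices: "\<And>\<eta>. {y. (\<eta>, y) \<in> S} \<in> null_sets lebesgue"
  shows "S \<in> null_sets (state_measure \<Delta> I B)"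
proof -
  have S_eq: "S = (\<Union>\<eta>\<in>well_filled I. {\<eta>} \<times> {y. (\<eta>, y) \<in> S})"
    using S by (auto simp: admissible_def)
  interpret L: sigma_finite_measure "lebesgue :: ((real^2) \<times> real) measure"
  proof
    show "\<exists>A::((real^2) \<times> real) set set. countable A \<and> A \<subseteq> sets lebesgue \<and> \<Union>A = space lebesgue \<and>
        (\<forall>a\<in>A. emeasure lebesgue a \<noteq> \<infinity>)"
      using lborel.sigma_finite_countable by fastforce
  qed
  have "{\<eta>} \<times> {y. (\<eta>, y) \<in> S} \<in> null_sets (count_space (well_filled I) \<Otimes>\<^sub>M lebesgue)"
    if "\<eta> \<in> well_filled I" for \<eta>
    using that slices [of \<eta>] null_setsD2 [OF slices [of \<eta>]]
    by (intro null_setsI) (auto simp: L.emeasure_pair_measure_Times)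
  then have "S \<in> null_sets (count_space (well_filled I) \<Otimes>\<^sub>M lebesgue)"
    by (subst S_eq) (intro null_sets_UN' countable_well_filled I)
  then show ?thesis unfolding state_measure_def using S by (rule null_sets_restrict_spaceI)
qed

theorem proposition2p3:
  fixes \<Delta> :: "(real^2) set" and I :: "'i set" and B :: "'i \<Rightarrow> (real^2) set"
  assumes "polygonal_domain \<Delta>"
    and "countable I"
    and "\<And>z. z \<in> I \<Longrightarrow> obstacle (B z)"
    and "\<And>z. z \<in> I \<Longrightarrow> B z \<subseteq> \<Delta>"
    and "disjoint_family_on (\<lambda>z. interior (B z)) I"
    and "\<And>x r. finite {z \<in> I. B z \<inter> ball x r \<noteq> {}}"
    and "uniformly_nondegenerate (insert \<Delta> (B ` I))"
  shows "singular_states \<Delta> I B \<in> null_sets (state_measure \<Delta> I B)"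
proof -
  interpret brick_breaker \<Delta> I B by unfold_locales (use assms in auto)
  show ?thesis
  proof (rule null_sets_state_measureI [OF assms(2)])
    show "singular_states \<Delta> I B \<subseteq> admissible \<Delta> I B" by (auto simp: singular_states_def)
    fix \<eta>
    have "(\<Union>q\<in>corner_images. {(x, \<theta>). \<exists>t. x + t *\<^sub>R dir \<theta> = q}) \<in> null_sets lebesgue"
      by (intro null_sets_UN' countable_corner_images null_sets_lines_through_point)
    moreover have "{y. (\<eta>, y) \<in> singular_states \<Delta> I B} \<subseteq>
        (\<Union>q\<in>corner_images. {(x, \<theta>). \<exists>t. x + t *\<^sub>R dir \<theta> = q})"
    proof clarify
      fix x \<theta>
      assume "(\<eta>, x, \<theta>) \<in> singular_states \<Delta> I B"
      then obtain t where "x + t *\<^sub>R dir \<theta> \<in> corner_images"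
        by (rule singular_state_aims_at_corner_image)
      then show "(x, \<theta>) \<in> (\<Union>q\<in>corner_images. {(x, \<theta>). \<exists>t. x + t *\<^sub>R dir \<theta> = q})"
        by auto
    qed
    ultimately show "{y. (\<eta>, y) \<in> singular_states \<Delta> I B} \<in> null_sets lebesgue"
      by (rule null_sets_completion_subset [rotated])
  qed
qed

end
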